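(* Let $\varphi$ be a linear fractional self-map of $\mathbb{D}$ which is either elliptic and non-automorphic, parabolic and non-automorphic, or hyperbolic. Let $p$ be the Denjoy-Wolff point of $\varphi$ and let $f$ be a self-map of $\mathbb{D}$ conformal at $p$. If $f\circ\varphi=\psi\circ f$ holds on $\mathbb{D}$ for some linear fractional self-map $\psi$ of $\mathbb{D}$, then $\psi\neq \mathrm{id}_{\mathbb{D}}$ and $f$ is also a linear fractional map.
   Context: $\mathbb{D}$ is the open unit disk in $\mathbb{C}$; $\mathrm{id}_{\mathbb{D}}$ is the identity map of $\mathbb{D}$. A self-map of $\mathbb{D}$ is a function analytic in $\mathbb{D}$ with $f(\mathbb{D})\subset\mathbb{D}$. A linear fractional map is a map of the form $z\mapsto (az+b)/(cz+d)$ with $ad-bc\ne0$. An automorphism is a bijective self-map of $\mathbb{D}$; non-automorphic means not an automorphism. Denjoy-Wolff point of a non-identity self-map $g$ of $\mathbb{D}$: if $g$ has a fixed point in $\mathbb{D}$ (necessarily unique), it is that point (also when $g$ is an automorphism), and $g$ is called elliptic; otherwise it is the unique point $p\in\partial\mathbb{D}$ to which the iterates of $g$ converge uniformly on compact subsets of $\mathbb{D}$, and then $g$ is called hyperbolic if its (angular) derivative satisfies $g'(p)<1$ and parabolic if $g'(p)=1$ (always $0<g'(p)\le1$). The symbol $\angle\lim$ denotes the angular (non-tangential) limit. A self-map $f$ of $\mathbb{D}$ is conformal at $p\in\partial\mathbb{D}$ if the angular limits $q=\angle\lim_{z\to p}f(z)\in\overline{\mathbb{D}}$ and $\angle\lim_{z\to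 p}\frac{f(z)-q}{z-p}$ exist and the latter is different from $0$ and $\infty$. If $p\in\mathbb{D}$, conformal at $p$ means $f'(p)\ne0$. *)

theory Defs
  imports "HOL-Complex_Analysis.Complex_Analysis"
begin

text \<open>Maps of the disk are functions of type \<^typ>\<open>complex \<Rightarrow> complex\<close>; only their values on
  the unit disk matter, so every notion below depends on the restriction to the disk only.\<close>

abbreviation unit_disk :: "complex set" where
  "unit_disk \<equiv> ball 0 1"

definition self_map :: "(complex \<Rightarrow> complex) \<Rightarrow> bool" where
  "self_map f \<longleftrightarrow> f holomorphic_on unit_disk \<and> f ` unit_disk \<subseteq> unit_disk"

definition automorphism :: "(complex \<Rightarrow> complex) \<Rightarrow> bool" where
  "automorphism f \<longleftrightarrow> self_map f \<and> bij_betw f unit_disk unit_disk"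

definition is_identity :: "(complex \<Rightarrow> complex) \<Rightarrow> bool" where
  "is_identity f \<longleftrightarrow> (\<forall>z\<in>unit_disk. f z = z)"

text \<open>The pole must lie outside the disk, since otherwise the convention \<open>x / 0 = 0\<close> would
  assign a finite value to it.\<close>

definition linear_fractional :: "(complex \<Rightarrow> complex) \<Rightarrow> bool" where
  "linear_fractional f \<longleftrightarrow>
     (\<exists>a b c d. a * d - b * c \<noteq> 0 \<and>
        (\<forall>z\<in>unit_disk. c * z + d \<noteq> 0 \<and> f z = (a * z + b) / (c * z + d)))"

definition stolz_region :: "real \<Rightarrow> complex \<Rightarrow> complex set" where
  "stolz_region M p = {z \<in> unit_disk. norm (z - p) < M * (1 - norm z)}"

definition has_angular_limit :: "(complex \<Rightarrow> complex) \<Rightarrow> complex \<Rightarrow> complex \<Rightarrow> bool" where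
  "has_angular_limit f p l \<longleftrightarrow> (\<forall>M>1. (f \<longlongrightarrow> l) (at p within stolz_region M p))"

text \<open>Meaningful for \<open>norm p = 1\<close>; the derivative is finite, being a complex number.\<close>

definition has_angular_derivative :: "(complex \<Rightarrow> complex) \<Rightarrow> complex \<Rightarrow> complex \<Rightarrow> bool" where
  "has_angular_derivative f p d \<longleftrightarrow>
     (\<exists>q\<in>cball 0 1. has_angular_limit f p q \<and>
        has_angular_limit (\<lambda>z. (f z - q) / (z - p)) p d)"

definition conformal_at :: "(complex \<Rightarrow> complex) \<Rightarrow> complex \<Rightarrow> bool" where
  "conformal_at f p \<longleftrightarrow>
     (p \<in> unit_disk \<and> deriv f p \<noteq> 0) \<or>
     (p \<in> sphere 0 1 \<and> (\<exists>d. d \<noteq> 0 \<and> has_angular_derivative f p d))"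

definition denjoy_wolff_point :: "(complex \<Rightarrow> complex) \<Rightarrow> complex \<Rightarrow> bool" where
  "denjoy_wolff_point g p \<longleftrightarrow>
     self_map g \<and> \<not> is_identity g \<and>
     (if \<exists>z\<in>unit_disk. g z = z then p \<in> unit_disk \<and> g p = p
      else p \<in> sphere 0 1 \<and>
        (\<forall>K. compact K \<and> K \<subseteq> unit_disk \<longrightarrow>
           uniform_limit K (\<lambda>n. g ^^ n) (\<lambda>_. p) sequentially))"

definition elliptic :: "(complex \<Rightarrow> complex) \<Rightarrow> bool" where
  "elliptic g \<longleftrightarrow> self_map g \<and> \<not> is_identity g \<and> (\<exists>z\<in>unit_disk. g z = z)"

text \<open>The angular derivative at a Denjoy-Wolff point on the circle is real, in the interval
  from \<open>0\<close> (excluded) to \<open>1\<close> (included).\<close>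

definition hyperbolic :: "(complex \<Rightarrow> complex) \<Rightarrow> bool" where
  "hyperbolic g \<longleftrightarrow>
     (\<exists>p (c::real). denjoy_wolff_point g p \<and> p \<in> sphere 0 1 \<and>
        has_angular_derivative g p (of_real c) \<and> c < 1)"

definition parabolic :: "(complex \<Rightarrow> complex) \<Rightarrow> bool" where
  "parabolic g \<longleftrightarrow>
     (\<exists>p. denjoy_wolff_point g p \<and> p \<in> sphere 0 1 \<and> has_angular_derivative g p 1)"

end

theory Submission
  imports Defs
begin

text \<open>
  The idea is to look at everything in coordinates that send the relevant fixed points to
  infinity. Let \<open>q\<close> be the (angular) limit of \<open>f\<close> at \<open>p\<close>. Orbits \<open>z\<^sub>n\<close> of \<open>\<phi>\<close> tend to \<open>p\<close>, so the orbits
  \<open>f z\<^sub>n\<close> of \<open>\<psi>\<close> tend to \<open>q\<close>, and \<open>\<psi>\<close> fixes \<open>q\<close>. In the coordinates \<open>1 / (p - z)\<close> and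
  \<open>1 / (q - w)\<close> both \<open>\<phi>\<close> and \<open>\<psi>\<close> are affine, with slopes \<open>A\<close> and \<open>B\<close> say, and \<open>f\<close> becomes a
  function \<open>F\<close> that semiconjugates one affine map to the other. Its derivative is
  \<open>h z = f' z * (z - p)\<^sup>2 / (f z - q)\<^sup>2\<close>, and differentiating the semiconjugacy gives
  \<open>h (\<phi> z) = (B / A) * h z\<close>.

  Conformality of \<open>f\<close> at \<open>p\<close>, with derivative \<open>d \<noteq> 0\<close>, says that \<open>h\<close> tends to \<open>1 / d\<close> along every
  orbit, provided that the orbit is non-tangential when \<open>p\<close> is on the circle. Since this limit is
  nonzero, \<open>B = A\<close>; hence \<open>h\<close> is constant along orbits and equal to \<open>1 / d\<close> everywhere. So \<open>F\<close> is
  affine, and \<open>f\<close> is linear fractional. Moreover \<open>f\<close> omits \<open>q\<close> away from \<open>p\<close>, which is impossible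
  if \<open>\<psi>\<close> is the identity, because then \<open>f z = f z\<^sub>n\<close> tends to \<open>q\<close>. This argument is
  \<open>semiconjugacy_linear_fractional\<close>; it treats all types of \<open>\<phi>\<close> at once.

  What depends on the type is only the behaviour of the orbits. In the elliptic case the Schwarz
  lemma shows that a non-automorphism has multiplier of modulus less than \<open>1\<close> at \<open>p\<close>, so that orbits
  starting near \<open>p\<close> tend to \<open>p\<close>; the identity theorem does the rest. In the boundary case a Cayley
  transform turns \<open>\<phi>\<close> into \<open>w \<mapsto> a * w + B\<close> on the right half-plane, with \<open>a > 1\<close> when \<open>\<phi>\<close> is
  hyperbolic, and \<open>a = 1\<close> and \<open>Re B > 0\<close> when \<open>\<phi>\<close> is parabolic and not an automorphism. In both
  cases the orbits of this affine map stay in a cone around the positive axis, which means that the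
  orbits of \<open>\<phi>\<close> are non-tangential (\<open>boundary_orbits_in_stolz_region\<close>). This fails for parabolic
  automorphisms. Cauchy's estimate shows that \<open>deriv f\<close> tends to \<open>d\<close> along such orbits
  (\<open>angular_limit_deriv\<close>).
\<close>

section \<open>Linear fractional maps at the limit of an orbit\<close>

text \<open>The orbit relation \<open>(c * u n + e) * u (n + 1) = a * u n + b\<close> is polynomial and passes to the limit,
  so that \<open>p\<close> is a fixed point even if it lies on the circle, where the values of \<open>g\<close> are
  arbitrary. The conclusion says that \<open>1 / (p - g z)\<close> is an affine function of \<open>1 / (p - z)\<close>.\<close>

lemma linear_fractional_at_orbit_limit:
  assumes lf: "linear_fractional g"
    and dom: "\<And>n. u n \<in> unit_disk"
    and orb: "\<And>n. u (Suc n) = g (u n)"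
    and lim: "u \<longlonglongrightarrow> p"
  obtains \<alpha> c e where "\<alpha> \<noteq> 0" and "c * p + e \<noteq> 0"
    and "\<And>z. z \<in> unit_disk \<Longrightarrow> c * z + e \<noteq> 0"
    and "\<And>z. z \<in> unit_disk \<Longrightarrow> g z = p + \<alpha> * (z - p) / (c * z + e)"
proof -
  obtain a b c e where det: "a * e - b * c \<noteq> 0"
    and g: "\<And>z. z \<in> unit_disk \<Longrightarrow> c * z + e \<noteq> 0 \<and> g z = (a * z + b) / (c * z + e)"
    using lf unfolding linear_fractional_def by blast
  have "(c * u n + e) * u (Suc n) = a * u n + b" for n
    using g[OF dom[of n]] by (simp add: orb)
  then have "(\<lambda>n. a * u n + b) = (\<lambda>n. (c * u n + e) * u (Suc n))"
    by simp
  moreover have "(\<lambda>n. a * u n + b) \<longlonglongrightarrow> a * p + b"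
    by (intro tendsto_intros lim)
  moreover have "(\<lambda>n. (c * u n + e) * u (Suc n)) \<longlonglongrightarrow> (c * p + e) * p"
    by (intro tendsto_intros lim LIMSEQ_Suc)
  ultimately have fix_p: "(c * p + e) * p = a * p + b"
    using LIMSEQ_unique by metis
  define \<alpha> where "\<alpha> = a - p * c"
  have prod: "\<alpha> * (c * p + e) = a * e - b * c"
  proof -
    have "\<alpha> * (c * p + e) - (a * e - b * c) = c * (a * p + b - (c * p + e) * p)"
      by (simp add: \<alpha>_def algebra_simps)
    then show ?thesis by (simp add: fix_p)
  qed
  show ?thesis
  proof
    show "\<alpha> \<noteq> 0" "c * p + e \<noteq> 0" using det prod by auto
    fix z assume z: "z \<in> unit_disk"
    show nz: "c * z + e \<noteq> 0" using g[OF z] by simp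
    have "a * z + b = p * (c * z + e) + \<alpha> * (z - p)"
      using fix_p by (simp add: \<alpha>_def algebra_simps)
    then show "g z = p + \<alpha> * (z - p) / (c * z + e)"
      using g[OF z] nz by (simp add: add_divide_distrib)
  qed
qed

text \<open>This is the derivative of the affine relation between \<open>1 / (p - z)\<close> and \<open>1 / (p - g z)\<close>, with the
  denominators cleared; \<open>A\<close> is the slope of the affine map.\<close>

lemma linear_fractional_deriv_scaling:
  assumes lf: "linear_fractional g"
    and dom: "\<And>n. u n \<in> unit_disk"
    and orb: "\<And>n. u (Suc n) = g (u n)"
    and lim: "u \<longlonglongrightarrow> p"
  obtains A where "A \<noteq> 0"
    and "\<And>z. z \<in> unit_disk \<Longrightarrow> deriv g z * (z - p)\<^sup>2 = A * (g z - p)\<^sup>2"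
proof -
  obtain \<alpha> c e where ne: "\<alpha> \<noteq> 0" "c * p + e \<noteq> 0"
    and den: "\<And>z. z \<in> unit_disk \<Longrightarrow> c * z + e \<noteq> 0"
    and g: "\<And>z. z \<in> unit_disk \<Longrightarrow> g z = p + \<alpha> * (z - p) / (c * z + e)"
    by (rule linear_fractional_at_orbit_limit[OF assms]) blast
  show ?thesis
  proof
    show "(c * p + e) / \<alpha> \<noteq> 0" using ne by simp
    fix z assume z: "z \<in> unit_disk"
    have "((\<lambda>z. p + \<alpha> * (z - p) / (c * z + e)) has_field_derivative
        \<alpha> * (c * p + e) / (c * z + e)\<^sup>2) (at z)"
      using den[OF z]
      by (auto intro!: derivative_eq_intros simp: field_simps power2_eq_square)
    then have "(g has_field_derivative \<alpha> * (c * p + e) / (c * z + e)\<^sup>2) (at z)"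
      by (rule has_field_derivative_transform_within_open[OF _ open_ball z]) (simp add: g)
    then have "deriv g z = \<alpha> * (c * p + e) / (c * z + e)\<^sup>2"
      by (rule DERIV_imp_deriv)
    then show "deriv g z * (z - p)\<^sup>2 = (c * p + e) / \<alpha> * (g z - p)\<^sup>2"
      using ne den[OF z] g[OF z] by (simp add: power_divide power_mult_distrib) (simp add: power2_eq_square)
  qed
qed

lemma linear_fractional_fixes_orbit_limit:
  assumes lf: "linear_fractional g"
    and dom: "\<And>n. u n \<in> unit_disk"
    and orb: "\<And>n. u (Suc n) = g (u n)"
    and lim: "u \<longlonglongrightarrow> p"
    and z: "z \<in> unit_disk"
  shows "g z = p \<longleftrightarrow> z = p"
  using linear_fractional_at_orbit_limit[OF lf dom orb lim] z by (smt (verit, best) add_cancel_left_right divide_eq_0_iff eq_iff_diff_eq_0 mult_eq_0_iff)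

section \<open>Semiconjugacies with a nonzero derivative along orbits\<close>

text \<open>Here \<open>d\<close> plays the role of the derivative of \<open>f\<close> at \<open>p\<close>, but it is only seen along the orbits of
  points of \<open>S\<close>. The set \<open>S\<close> is the whole disk if \<open>p\<close> is on the circle, and a small punctured disk
  around \<open>p\<close> if \<open>p\<close> is an interior point.\<close>

lemma semiconjugacy_linear_fractional:
  assumes lf\<phi>: "linear_fractional \<phi>" and lf\<psi>: "linear_fractional \<psi>"
    and hol\<phi>: "\<phi> holomorphic_on unit_disk" and hol\<psi>: "\<psi> holomorphic_on unit_disk"
    and f: "self_map f"
    and semi: "\<And>z. z \<in> unit_disk \<Longrightarrow> f (\<phi> z) = \<psi> (f z)"
    and S: "open S" "connected S" "S \<noteq> {}" "S \<subseteq> unit_disk" "p \<notin> S"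
    and inv: "\<And>z. z \<in> S \<Longrightarrow> \<phi> z \<in> S"
    and d: "d \<noteq> 0"
    and lim: "\<And>z. z \<in> S \<Longrightarrow> (\<lambda>n. (\<phi> ^^ n) z) \<longlonglongrightarrow> p"
    and quot: "\<And>z. z \<in> S \<Longrightarrow>
      (\<lambda>n. (f ((\<phi> ^^ n) z) - q) / ((\<phi> ^^ n) z - p)) \<longlonglongrightarrow> d"
    and der: "\<And>z. z \<in> S \<Longrightarrow> (\<lambda>n. deriv f ((\<phi> ^^ n) z)) \<longlonglongrightarrow> d"
  shows "\<not> is_identity \<psi> \<and> linear_fractional f"
proof -
  have holf: "f holomorphic_on unit_disk" and fD: "\<And>z. z \<in> unit_disk \<Longrightarrow> f z \<in> unit_disk"
    using f unfolding self_map_def by blast+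
  have orbS: "(\<phi> ^^ n) z \<in> S" if "z \<in> S" for z n
    using that by (induction n) (auto intro: inv)
  have orbD: "(\<phi> ^^ n) z \<in> unit_disk" if "z \<in> S" for z n
    using orbS[OF that] S by blast
  have limf: "(\<lambda>n. f ((\<phi> ^^ n) z)) \<longlonglongrightarrow> q" if z: "z \<in> S" for z
  proof -
    have "(\<lambda>n. (f ((\<phi> ^^ n) z) - q) / ((\<phi> ^^ n) z - p) * ((\<phi> ^^ n) z - p)) \<longlonglongrightarrow> d * (p - p)"
      by (intro tendsto_intros quot lim z)
    moreover have "(\<phi> ^^ n) z - p \<noteq> 0" for n
      using orbS[OF z] S by (metis right_minus_eq)
    ultimately have "(\<lambda>n. f ((\<phi> ^^ n) z) - q) \<longlonglongrightarrow> 0" by simp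
    then show ?thesis by (rule LIM_zero_cancel)
  qed
  have step: "f ((\<phi> ^^ Suc n) z) = \<psi> (f ((\<phi> ^^ n) z))" if "z \<in> S" for z n
    using semi[OF orbD[OF that]] by simp
  have not_const: "\<not> (\<forall>n. f ((\<phi> ^^ n) z) = q)" if z: "z \<in> S" for z
  proof
    assume "\<forall>n. f ((\<phi> ^^ n) z) = q"
    then have "(\<lambda>n. 0) \<longlonglongrightarrow> d" using quot[OF z] by simp
    then show False using d by (simp add: LIMSEQ_const_iff)
  qed
  obtain z0 where z0: "z0 \<in> S" using S by blast
  obtain A where A: "A \<noteq> 0"
    "\<And>z. z \<in> unit_disk \<Longrightarrow> deriv \<phi> z * (z - p)\<^sup>2 = A * (\<phi> z - p)\<^sup>2"
    by (rule linear_fractional_deriv_scaling[OF lf\<phi> orbD[OF z0] _ lim[OF z0]]) auto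
  obtain B where B: "B \<noteq> 0"
    "\<And>w. w \<in> unit_disk \<Longrightarrow> deriv \<psi> w * (w - q)\<^sup>2 = B * (\<psi> w - q)\<^sup>2"
    by (rule linear_fractional_deriv_scaling[OF lf\<psi> fD[OF orbD[OF z0]] step[OF z0] limf[OF z0]]) blast
  have fix_q: "\<psi> w = q \<longleftrightarrow> w = q" if "w \<in> unit_disk" for w
    by (rule linear_fractional_fixes_orbit_limit[OF lf\<psi> fD[OF orbD[OF z0]] step[OF z0] limf[OF z0] that])
  \<comment> \<open>If \<open>f\<close> took the value \<open>q\<close> at \<open>z\<close>, it would do so along the whole orbit, since \<open>\<psi>\<close> fixes \<open>q\<close>,
    and the difference quotients would tend to \<open>0\<close> rather than \<open>d\<close>.\<close>
  have fq: "f z \<noteq> q" if z: "z \<in> S" for z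
  proof
    assume "f z = q"
    then have "f ((\<phi> ^^ n) z) = q" for n
    proof (induction n)
      case (Suc n)
      then show ?case using step[OF z, of n] fix_q[OF fD[OF orbD[OF z, of n]]] by simp
    qed simp
    then show False using not_const[OF z] by blast
  qed
  have not_id: "\<not> is_identity \<psi>"
  proof
    assume "is_identity \<psi>"
    then have "f ((\<phi> ^^ n) z0) = f z0" for n
      by (induction n) (use step[OF z0] fD[OF orbD[OF z0]] in \<open>auto simp: is_identity_def\<close>)
    then have "f z0 = q" using limf[OF z0] by (simp add: LIMSEQ_const_iff)
    then show False using fq[OF z0] by simp
  qed
  \<comment> \<open>The derivative of \<open>1 / (q - f z)\<close> with respect to \<open>1 / (p - z)\<close>, written in this form so that
    both parts have known limits along the orbits.\<close>
  define h where "h z = deriv f z / ((f z - q) / (z - p))\<^sup>2" for z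
  have h_step: "h (\<phi> z) = B / A * h z" if z: "z \<in> S" for z
  proof -
    have zD: "z \<in> unit_disk" and \<phi>S: "\<phi> z \<in> S" and \<phi>D: "\<phi> z \<in> unit_disk"
      using z S inv by blast+
    have ne: "z - p \<noteq> 0" "\<phi> z - p \<noteq> 0" "f z - q \<noteq> 0" "f (\<phi> z) - q \<noteq> 0"
      using z \<phi>S S fq by auto
    have d\<phi>: "(\<phi> has_field_derivative deriv \<phi> z) (at z)"
      using hol\<phi> zD holomorphic_derivI open_ball by blast
    have "((\<lambda>z. f (\<phi> z)) has_field_derivative deriv f (\<phi> z) * deriv \<phi> z) (at z)"
      using DERIV_chain2[OF holomorphic_derivI[OF holf open_ball \<phi>D] d\<phi>] .
    moreover have "((\<lambda>z. \<psi> (f z)) has_field_derivative deriv \<psi> (f z) * deriv f z) (at z)"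
      using DERIV_chain2[OF holomorphic_derivI[OF hol\<psi> open_ball fD[OF zD]]
          holomorphic_derivI[OF holf open_ball zD]] .
    then have "((\<lambda>z. f (\<phi> z)) has_field_derivative deriv \<psi> (f z) * deriv f z) (at z)"
      by (rule has_field_derivative_transform_within_open[OF _ open_ball zD]) (simp add: semi)
    ultimately have chain: "deriv f (\<phi> z) * deriv \<phi> z = deriv \<psi> (f z) * deriv f z"
      by (rule DERIV_unique)
    have e1: "deriv \<phi> z = A * (\<phi> z - p)\<^sup>2 / (z - p)\<^sup>2"
      using A(2)[OF zD] ne by (simp add: eq_divide_eq)
    have e2: "deriv \<psi> (f z) = B * (f (\<phi> z) - q)\<^sup>2 / (f z - q)\<^sup>2"
      using B(2)[OF fD[OF zD]] ne by (simp add: eq_divide_eq semi[OF zD])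
    have "deriv \<phi> z \<noteq> 0" using e1 A(1) ne by simp
    then have "deriv f (\<phi> z) = deriv \<psi> (f z) * deriv f z / deriv \<phi> z"
      using chain by (simp add: eq_divide_eq)
    then show ?thesis
      unfolding h_def using A(1) ne by (simp add: e1 e2 field_simps)
  qed
  have h_lim: "(\<lambda>n. h ((\<phi> ^^ n) z)) \<longlonglongrightarrow> 1 / d" if z: "z \<in> S" for z
  proof -
    have "(\<lambda>n. h ((\<phi> ^^ n) z)) \<longlonglongrightarrow> d / d\<^sup>2"
      unfolding h_def using d by (intro tendsto_intros der quot z) auto
    then show ?thesis using d by (simp add: power2_eq_square)
  qed
  \<comment> \<open>The values of \<open>h\<close> along an orbit are a geometric progression with ratio \<open>B / A\<close> and a nonzero
    limit.\<close>
  have "B / A = 1"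
  proof -
    have "(\<lambda>n. h ((\<phi> ^^ Suc n) z0)) \<longlonglongrightarrow> 1 / d"
      using h_lim[OF z0] by (rule LIMSEQ_Suc)
    moreover have "(\<lambda>n. h ((\<phi> ^^ Suc n) z0)) = (\<lambda>n. B / A * h ((\<phi> ^^ n) z0))"
      using h_step[OF orbS[OF z0]] by simp
    moreover have "(\<lambda>n. B / A * h ((\<phi> ^^ n) z0)) \<longlonglongrightarrow> B / A * (1 / d)"
      by (intro tendsto_intros h_lim z0)
    ultimately have "1 / d = B / A * (1 / d)"
      using LIMSEQ_unique by metis
    then show ?thesis using d by (metis divide_eq_0_iff mult_cancel_right1 mult.commute one_neq_zero)
  qed
  have h_const: "h z = 1 / d" if z: "z \<in> S" for z
  proof -
    have "h ((\<phi> ^^ n) z) = h z" for n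
      by (induction n) (use h_step[OF orbS[OF z]] \<open>B / A = 1\<close> in auto)
    then show ?thesis using h_lim[OF z] by (simp add: LIMSEQ_const_iff)
  qed
  have der0: "((\<lambda>z. 1 / (q - f z) - 1 / d / (p - z)) has_field_derivative 0) (at z)" if z: "z \<in> S" for z
  proof -
    have ne: "z - p \<noteq> 0" "f z - q \<noteq> 0" "p - z \<noteq> 0" "q - f z \<noteq> 0" using z S fq by auto
    have "(f has_field_derivative deriv f z) (at z)"
      using holf z S holomorphic_derivI open_ball by blast
    then have "((\<lambda>z. 1 / (q - f z)) has_field_derivative deriv f z / (q - f z)\<^sup>2) (at z)"
      using ne by (auto intro!: derivative_eq_intros simp: power2_eq_square)
    moreover have "((\<lambda>z. 1 / d / (p - z)) has_field_derivative 1 / d / (p - z)\<^sup>2) (at z)"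
      using ne d by (auto intro!: derivative_eq_intros simp: power2_eq_square)
    ultimately have "((\<lambda>z. 1 / (q - f z) - 1 / d / (p - z)) has_field_derivative
        deriv f z / (q - f z)\<^sup>2 - 1 / d / (p - z)\<^sup>2) (at z)"
      by (rule DERIV_diff)
    moreover have "deriv f z / (q - f z)\<^sup>2 = 1 / d / (p - z)\<^sup>2"
      using h_const[OF z] ne d unfolding h_def
      by (simp add: field_simps power2_commute[of q] power2_commute[of p])
    ultimately show ?thesis by simp
  qed
  obtain C where C: "\<And>z. z \<in> S \<Longrightarrow> 1 / (q - f z) - 1 / d / (p - z) = C"
  proof (rule DERIV_zero_connected_constant[OF S(2,1) finite.emptyI])
    show "continuous_on S (\<lambda>z. 1 / (q - f z) - 1 / d / (p - z))"
      by (rule DERIV_continuous_on[where D = "\<lambda>_. 0"])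
        (rule has_field_derivative_at_within[OF der0])
  qed (use der0 in blast)+
  have eqS: "(q - f z) * (1 + C * d * (p - z)) - d * (p - z) = 0" if "z \<in> S" for z
  proof -
    have ne: "p - z \<noteq> 0" "q - f z \<noteq> 0" using that S fq by auto
    define u v where "u = p - z" and "v = q - f z"
    have "1 / v = C + 1 / d / u"
      using C[OF that] by (simp add: u_def v_def diff_eq_eq)
    moreover have "u \<noteq> 0" "v \<noteq> 0" using ne by (auto simp: u_def v_def)
    ultimately have "d * u = v + C * (d * (u * v))" using d by (simp add: field_simps)
    moreover have "v * (1 + C * d * u) = v + C * (d * (u * v))" by (simp add: algebra_simps)
    ultimately have "v * (1 + C * d * u) - d * u = 0" by simp
    then show ?thesis by (simp add: u_def v_def)
  qed
  \<comment> \<open>Without denominators the relation is an identity between holomorphic functions on the disk,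
    and it extends from \<open>S\<close> to the whole disk.\<close>
  have eqD: "(q - f z) * (1 + C * d * (p - z)) = d * (p - z)" if z: "z \<in> unit_disk" for z
  proof -
    have "(\<lambda>z. (q - f z) * (1 + C * d * (p - z)) - d * (p - z)) holomorphic_on unit_disk"
      by (intro holomorphic_intros holf)
    moreover have "z0 islimpt S"
      using S(1) z0 by (simp add: interior_limit_point interior_open)
    ultimately have "(q - f z) * (1 + C * d * (p - z)) - d * (p - z) = 0"
      using analytic_continuation[of "\<lambda>z. (q - f z) * (1 + C * d * (p - z)) - d * (p - z)"
          unit_disk S z0 z] S z0 eqS z by blast
    then show ?thesis by simp
  qed
  have "linear_fractional f"
    unfolding linear_fractional_def
  proof (intro exI conjI ballI)
    \<comment> \<open>The solution of \<open>eqD\<close> for \<open>f z\<close>; its determinant is \<open>d\<close>.\<close>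
    let ?a = "d - q * C * d" and ?b = "q * (1 + C * d * p) - d * p"
      and ?c = "- C * d" and ?e = "1 + C * d * p"
    show "?a * ?e - ?b * ?c \<noteq> 0"
      using d by (simp add: algebra_simps)
    fix z assume z: "z \<in> unit_disk"
    show nz: "?c * z + ?e \<noteq> 0"
    proof
      assume "?c * z + ?e = 0"
      then have "1 + C * d * (p - z) = 0" by (simp add: algebra_simps)
      then show False using eqD[OF z] d by auto
    qed
    show "f z = (?a * z + ?b) / (?c * z + ?e)"
      using eqD[OF z] nz by (simp add: eq_divide_eq algebra_simps)
  qed
  with not_id show ?thesis by blast
qed

section \<open>Angular limits and derivatives\<close>

text \<open>On a disk of radius \<open>(1 - \<bar>z\<bar>) / 2\<close> around a point \<open>z\<close> of a Stolz region, the remainder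
  \<open>f x - q - d * (x - p)\<close> is small compared with \<open>\<bar>x - p\<bar>\<close>, since the disk lies in a larger Stolz
  region, and hence small compared with the radius. Cauchy's estimate bounds the derivative of the
  remainder.\<close>

lemma angular_limit_deriv:
  assumes hol: "f holomorphic_on unit_disk"
    and quot: "has_angular_limit (\<lambda>z. (f z - q) / (z - p)) p d"
    and p: "norm p = 1"
  shows "has_angular_limit (deriv f) p d"
  unfolding has_angular_limit_def
proof (intro allI impI)
  fix M :: real assume M: "M > 1"
  \<comment> \<open>The disk of radius \<open>r = (1 - \<bar>z\<bar>) / 2\<close> around \<open>z\<close> lies in the region with this aperture:
    \<open>\<bar>x - p\<bar> < 2 * M * r + r\<close> and \<open>r \<le> 1 - \<bar>x\<bar>\<close>.\<close>
  define N where "N = 2 * M + 1"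
  have N: "N > 1" using M by (simp add: N_def)
  show "(deriv f \<longlongrightarrow> d) (at p within stolz_region M p)"
    unfolding Lim_within
  proof (intro allI impI)
    fix e :: real assume e: "e > 0"
    have "((\<lambda>z. (f z - q) / (z - p)) \<longlongrightarrow> d) (at p within stolz_region N p)"
      using quot N by (simp add: has_angular_limit_def)
    moreover have "e / (2 * N) > 0" using e N by simp
    ultimately obtain \<delta> where \<delta>: "\<delta> > 0"
      and lim: "\<And>x. x \<in> stolz_region N p \<Longrightarrow> 0 < dist x p \<Longrightarrow> dist x p < \<delta> \<Longrightarrow>
        dist ((f x - q) / (x - p)) d < e / (2 * N)"
      unfolding Lim_within by meson
    show "\<exists>\<delta>>0. \<forall>z\<in>stolz_region M p. 0 < dist z p \<and> dist z p < \<delta> \<longrightarrow> dist (deriv f z) d < e"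
    proof (intro exI[of _ "\<delta> / 2"] conjI ballI impI)
      show "\<delta> / 2 > 0" using \<delta> by simp
      fix z assume z: "z \<in> stolz_region M p" and zp: "0 < dist z p \<and> dist z p < \<delta> / 2"
      have zD: "norm z < 1" and zM: "norm (z - p) < M * (1 - norm z)"
        using z by (auto simp: stolz_region_def)
      define r where "r = (1 - norm z) / 2"
      have r: "r > 0" using zD by (simp add: r_def)
      have sub: "cball z r \<subseteq> unit_disk"
      proof
        fix x assume "x \<in> cball z r"
        then have "norm (z - x) \<le> r" by (simp add: dist_norm)
        then have "norm x \<le> norm z + r" using norm_triangle_ineq4[of z "z - x"] by simp
        then show "x \<in> unit_disk" using zD by (simp add: r_def field_simps)
      qed
      define R where "R x = f x - q - d * (x - p)" for x
      have holR: "R holomorphic_on unit_disk"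
        unfolding R_def by (intro holomorphic_intros hol)
      have bound: "norm (R x) \<le> e / (2 * N) * (N * r)" if x: "norm (z - x) = r" for x
      proof -
        have xD: "x \<in> unit_disk" using sub x by (auto simp: dist_norm)
        have "norm (x - p) \<le> norm (z - p) + norm (z - x)"
          using norm_triangle_ineq4[of "z - p" "z - x"] by simp
        moreover have "norm x \<le> norm z + norm (z - x)"
          using norm_triangle_ineq4[of z "z - x"] by simp
        moreover have r2: "1 - norm z = 2 * r" and Nr: "N * r = M * (2 * r) + r"
          by (simp_all add: r_def N_def algebra_simps add_divide_distrib diff_divide_distrib)
        moreover have "norm (z - p) < M * (2 * r)" using zM r2 by simp
        ultimately have xp: "norm (x - p) < N * r" and nx: "r \<le> 1 - norm x"
          and near: "norm (x - p) \<le> norm (z - p) + r"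
          using x by linarith+
        have "1 - norm z \<le> norm (z - p)"
          using norm_triangle_ineq2[of p z] p by (simp add: norm_minus_commute)
        moreover have "norm (z - p) < \<delta> / 2" using zp by (simp add: dist_norm)
        ultimately have "norm (x - p) < \<delta>" using near r2 \<delta> by linarith
        moreover have "x \<noteq> p" using xD p by auto
        moreover have "x \<in> stolz_region N p"
          using less_le_trans[OF xp mult_left_mono[OF nx]] xD N by (simp add: stolz_region_def)
        ultimately have small: "norm ((f x - q) / (x - p) - d) < e / (2 * N)"
          using lim[of x] by (simp add: dist_norm)
        have "R x = ((f x - q) / (x - p) - d) * (x - p)"
          using \<open>x \<noteq> p\<close> unfolding R_def left_diff_distrib[of _ d "x - p"] by simp
        moreover have "norm ((f x - q) / (x - p) - d) * norm (x - p) \<le> e / (2 * N) * (N * r)"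
          by (rule mult_mono) (use small xp e N in \<open>simp_all add: less_imp_le\<close>)
        ultimately show ?thesis by (simp only: norm_mult)
      qed
      have "norm ((deriv ^^ 1) R z) \<le> fact 1 * (e / (2 * N) * (N * r)) / r ^ 1"
      proof (rule Cauchy_inequality)
        show "R holomorphic_on ball z r"
          using holR subset_trans[OF ball_subset_cball sub] by (rule holomorphic_on_subset)
        show "continuous_on (cball z r) R"
          using holR sub by (intro holomorphic_on_imp_continuous_on) (rule holomorphic_on_subset)
      qed (use r bound in auto)
      then have "norm (deriv R z) \<le> e / 2" using r N by simp
      moreover have "deriv R z = deriv f z - d"
        unfolding R_def
        by (rule DERIV_imp_deriv)
          (use holomorphic_derivI[OF hol open_ball, of z] zD in
            \<open>auto intro!: derivative_eq_intros\<close>)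
      ultimately show "dist (deriv f z) d < e" using e by (simp add: dist_norm)
    qed
  qed
qed

lemma stolz_region_islimpt:
  assumes p: "norm p = 1" and M: "M > 1"
  shows "p islimpt stolz_region M p"
  unfolding islimpt_sequential
proof (intro exI conjI allI)
  define u :: "nat \<Rightarrow> complex" where "u n = (1 - of_real (inverse (real (Suc n)))) * p" for n
  have "u \<longlonglongrightarrow> (1 - of_real 0) * p"
    unfolding u_def by (intro tendsto_intros LIMSEQ_inverse_real_of_nat)
  then show "u \<longlonglongrightarrow> p" by simp
  fix n
  have "u n - p = - of_real (inverse (real (Suc n))) * p" by (simp add: u_def algebra_simps)
  then have d: "norm (u n - p) = inverse (real (Suc n))"
    by (simp only: norm_mult norm_minus_cancel norm_of_real p) simp
  have "u n = of_real (1 - inverse (real (Suc n))) * p" by (simp add: u_def)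
  then have "norm (u n) = \<bar>1 - inverse (real (Suc n))\<bar>" by (simp only: norm_mult norm_of_real p mult_1_right)
  then have n: "norm (u n) = 1 - inverse (real (Suc n))" by (simp add: inverse_eq_divide)
  show "u n \<in> stolz_region M p - {p}"
  proof -
    define t where "t = inverse (real (Suc n))"
    have t: "t > 0" by (simp add: t_def)
    then have "norm (u n) < 1" "norm (u n - p) < M * (1 - norm (u n))" "u n - p \<noteq> 0"
      using d n M unfolding t_def[symmetric] by auto
    then show ?thesis by (simp add: stolz_region_def)
  qed
qed

text \<open>The quotient in the assumption uses the centre \<open>p\<close>, whereas the angular derivative comes with its
  own limit value \<open>q\<close>. The assumption forces \<open>q = p\<close>.\<close>

lemma angular_derivative_unique:
  assumes p: "norm p = 1" and c: "has_angular_derivative \<phi> p c"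
    and lim: "((\<lambda>z. (\<phi> z - p) / (z - p)) \<longlongrightarrow> l) (at p within unit_disk)"
  shows "c = l"
proof -
  obtain q where q: "has_angular_limit \<phi> p q"
    and qq: "has_angular_limit (\<lambda>z. (\<phi> z - q) / (z - p)) p c"
    using c unfolding has_angular_derivative_def by blast
  have nb: "at p within stolz_region 2 p \<noteq> bot"
    using stolz_region_islimpt[OF p, of 2] by (simp add: trivial_limit_within)
  have sub: "stolz_region 2 p \<subseteq> unit_disk" by (auto simp: stolz_region_def)
  have lim2: "((\<lambda>z. (\<phi> z - p) / (z - p)) \<longlongrightarrow> l) (at p within stolz_region 2 p)"
    using lim sub by (rule tendsto_within_subset)
  have id: "((\<lambda>z. z - p) \<longlongrightarrow> p - p) (at p within stolz_region 2 p)"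
    by (intro tendsto_intros)
  have np: "\<forall>\<^sub>F z in at p within stolz_region 2 p. z \<noteq> p"
    by (simp add: eventually_at_filter)
  have "((\<lambda>z. (\<phi> z - p) / (z - p) * (z - p) + p) \<longlongrightarrow> l * (p - p) + p) (at p within stolz_region 2 p)"
    by (intro tendsto_intros lim2 id)
  moreover have "\<forall>\<^sub>F z in at p within stolz_region 2 p. (\<phi> z - p) / (z - p) * (z - p) + p = \<phi> z"
    using np by eventually_elim simp
  ultimately have "(\<phi> \<longlongrightarrow> l * (p - p) + p) (at p within stolz_region 2 p)"
    by (rule Lim_transform_eventually)
  then have "(\<phi> \<longlongrightarrow> p) (at p within stolz_region 2 p)" by simp
  moreover have "(\<phi> \<longlongrightarrow> q) (at p within stolz_region 2 p)"
    using q by (simp add: has_angular_limit_def)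
  ultimately have "p = q" by (rule tendsto_unique[OF nb])
  then have "((\<lambda>z. (\<phi> z - p) / (z - p)) \<longlongrightarrow> c) (at p within stolz_region 2 p)"
    using qq by (simp add: has_angular_limit_def)
  then show ?thesis using lim2 by (rule tendsto_unique[OF nb])
qed

section \<open>The Cayley transform\<close>

text \<open>For \<open>\<bar>p\<bar> = 1\<close> this maps the unit disk onto the right half-plane and sends \<open>p\<close> to infinity.\<close>

definition cayley :: "complex \<Rightarrow> complex \<Rightarrow> complex" where
  "cayley p z = (p + z) / (p - z)"

lemma cayley_plus_one: "z \<noteq> p \<Longrightarrow> cayley p z + 1 = 2 * p / (p - z)"
  by (simp add: cayley_def field_simps)

lemma Re_cayley:
  assumes p: "norm p = 1" and z: "z \<noteq> p"
  shows "Re (cayley p z) = (1 - (norm z)\<^sup>2) / (norm (p - z))\<^sup>2"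
proof -
  have "Re ((p + z) * cnj (p - z)) = (norm p)\<^sup>2 - (norm z)\<^sup>2"
    unfolding cmod_power2 by (simp add: power2_eq_square algebra_simps)
  moreover have "cayley p z = (p + z) * cnj (p - z) / of_real ((norm (p - z))\<^sup>2)"
    unfolding cayley_def by (rule complex_div_cnj)
  ultimately show ?thesis by (simp add: p Re_divide_of_real)
qed

lemma cayley_surj:
  assumes p: "norm p = 1" and w: "Re w > 0"
  obtains z where "z \<in> unit_disk" "cayley p z = w"
proof
  have ne: "w + 1 \<noteq> 0"
  proof
    assume "w + 1 = 0"
    then have "w = - 1" by (simp add: eq_neg_iff_add_eq_0)
    then show False using w by simp
  qed
  define z where "z = p * (w - 1) / (w + 1)"
  have "(norm (w - 1))\<^sup>2 < (norm (w + 1))\<^sup>2"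
    unfolding cmod_power2 using w by (simp add: power2_eq_square algebra_simps)
  then have "norm (w - 1) < norm (w + 1)" by (rule power_less_imp_less_base) simp
  then show "z \<in> unit_disk" using ne by (simp add: z_def norm_divide norm_mult p)
  have "p \<noteq> 0" using p by auto
  have "z * (w + 1) = p * (w - 1)" using ne by (simp add: z_def)
  then have "(p + z) * (w + 1) = 2 * p * w" "(p - z) * (w + 1) = 2 * p"
    unfolding distrib_right[of p z] left_diff_distrib[of p z] by (simp_all add: algebra_simps)
  then have "p + z = 2 * p * w / (w + 1)" "p - z = 2 * p / (w + 1)"
    using ne by (metis nonzero_mult_div_cancel_right)+
  then show "cayley p z = w" unfolding cayley_def using \<open>p \<noteq> 0\<close> ne by simp
qed

lemma cayley_inj:
  assumes p: "norm p = 1" and "z \<in> unit_disk" "w \<in> unit_disk" "cayley p z = cayley p w"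
  shows "z = w"
proof -
  have ne: "z \<noteq> p" "w \<noteq> p" "p \<noteq> 0" using assms by auto
  then have "2 * p / (p - z) = 2 * p / (p - w)"
    using assms(4) cayley_plus_one[of z p] cayley_plus_one[of w p] by metis
  then have "2 * p * (p - w) = 2 * p * (p - z)"
    using ne by (subst (asm) frac_eq_eq) auto
  then show ?thesis using ne by simp
qed

text \<open>Cones around the positive axis in the half-plane correspond to Stolz regions at \<open>p\<close>:
  \<open>\<bar>w + 1\<bar> / Re w = 2 * \<bar>p - z\<bar> / (1 - \<bar>z\<bar>\<^sup>2)\<close> for \<open>w = cayley p z\<close>.\<close>

lemma norm_diff_le_of_cayley_cone:
  assumes p: "norm p = 1" and z: "z \<in> unit_disk" and K: "K \<ge> 0"
    and cone: "norm (cayley p z + 1) \<le> K * Re (cayley p z)"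
  shows "norm (z - p) \<le> K * (1 - norm z)"
proof -
  have ne: "z \<noteq> p" using p z by auto
  define t where "t = norm (p - z)"
  have t: "t > 0" using ne by (simp add: t_def)
  have "2 / t \<le> K * ((1 - (norm z)\<^sup>2) / t\<^sup>2)"
    using cone unfolding cayley_plus_one[OF ne] Re_cayley[OF p ne]
    by (simp add: norm_divide norm_mult p t_def)
  then have "2 * t \<le> K * (1 - (norm z)\<^sup>2)"
    using t by (simp add: divide_simps power2_eq_square)
  also have "1 - (norm z)\<^sup>2 = (1 - norm z) * (1 + norm z)"
    by (simp add: power2_eq_square algebra_simps)
  also have "K * ((1 - norm z) * (1 + norm z)) \<le> K * ((1 - norm z) * 2)"
    using z K by (intro mult_left_mono) auto
  finally have "t \<le> K * (1 - norm z)" by linarith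
  then show ?thesis by (simp add: t_def norm_minus_commute)
qed

text \<open>If \<open>A\<close> were not real and positive, it would rotate some ray of the half-plane out of it; letting
  \<open>w\<close> tend to \<open>0\<close> gives the condition on \<open>B\<close>.\<close>

lemma affine_preserving_half_plane:
  assumes A: "A \<noteq> 0" and pres: "\<And>w. Re w > 0 \<Longrightarrow> Re (A * w + B) > 0"
  obtains a where "a > 0" "A = of_real a" "Re B \<ge> 0"
proof
  have im: "Im A = 0"
  proof (rule ccontr)
    assume n: "Im A \<noteq> 0"
    \<comment> \<open>A point of the line \<open>Re w = 1\<close> that is mapped to the imaginary axis.\<close>
    define w where "w = Complex 1 ((Re A + Re B) / Im A)"
    have "Re (A * w + B) = 0" using n by (simp add: w_def)
    then show False using pres[of w] by (simp add: w_def)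
  qed
  have pos: "Re A * x + Re B > 0" if "x > 0" for x
    using pres[of "of_real x"] that by simp
  have "Re A \<ge> 0"
  proof (rule ccontr)
    assume n: "\<not> Re A \<ge> 0"
    define x where "x = (\<bar>Re B\<bar> + 1) / (- Re A)"
    have "x > 0" unfolding x_def using n by (intro divide_pos_pos) auto
    moreover have "Re A * x = - (\<bar>Re B\<bar> + 1)" using n by (simp add: x_def nonzero_divide_eq_eq)
    ultimately show False using pos[of x] by simp
  qed
  then show "Re A > 0" using A im by (simp add: complex_eq_iff)
  show "A = of_real (Re A)" using im by (simp add: complex_eq_iff)
  show "Re B \<ge> 0"
  proof (rule ccontr)
    assume "\<not> Re B \<ge> 0"
    then show False using pos[of "- Re B / Re A"] \<open>Re A > 0\<close> by (simp add: divide_neg_pos)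
  qed
qed

text \<open>The inequality \<open>\<bar>w\<bar> + \<beta> \<le> K * Re w\<close> describes a cone that is mapped into itself if
  \<open>\<bar>B\<bar> \<le> (a - 1) * \<beta> + K * Re B\<close>. If \<open>a > 1\<close>, a large \<open>\<beta>\<close> achieves this; if \<open>Re B > 0\<close>, a large \<open>K\<close>
  does. With \<open>\<beta> \<ge> 1\<close> the cone inequality bounds \<open>\<bar>w + 1\<bar>\<close> too.\<close>

lemma affine_orbit_in_cone:
  fixes W :: "nat \<Rightarrow> complex"
  assumes rec: "\<And>n. W (Suc n) = of_real a * W n + B"
    and a: "a \<ge> 1" and ReB: "Re B \<ge> 0" and exp: "a > 1 \<or> Re B > 0"
    and W0: "Re (W 0) > 0"
  obtains K where "K \<ge> 0" "\<And>n. norm (W n + 1) \<le> K * Re (W n)"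
proof -
  obtain \<beta> K where \<beta>: "\<beta> \<ge> 1" and K: "K \<ge> 0" and B: "norm B \<le> (a - 1) * \<beta> + K * Re B"
    and start: "norm (W 0) + \<beta> \<le> K * Re (W 0)"
  proof (cases "a > 1")
    case True
    define \<beta> where "\<beta> = norm B / (a - 1) + 1"
    define K where "K = (norm (W 0) + \<beta>) / Re (W 0)"
    have \<beta>: "\<beta> \<ge> 1" using True by (simp add: \<beta>_def)
    have K: "K \<ge> 0" using \<beta> W0 by (auto simp: K_def)
    have "(a - 1) * \<beta> = norm B + (a - 1)" using True by (simp add: \<beta>_def distrib_left)
    then have "norm B \<le> (a - 1) * \<beta>" using True by simp
    then show ?thesis using that[OF \<beta> K] mult_nonneg_nonneg[OF K ReB] W0 by (simp add: K_def)
  next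
    case False
    then have b: "Re B > 0" using exp by simp
    define K where "K = max (norm B / Re B) ((norm (W 0) + 1) / Re (W 0))"
    have K: "K \<ge> 0" using b by (simp add: K_def le_max_iff_disj)
    have "norm B / Re B \<le> K" "(norm (W 0) + 1) / Re (W 0) \<le> K" by (auto simp: K_def)
    then show ?thesis using that[of 1 K] K b W0 False a by (simp add: divide_le_eq)
  qed
  have "norm (W n) + \<beta> \<le> K * Re (W n)" for n
  proof (induction n)
    case 0
    then show ?case by (rule start)
  next
    case (Suc n)
    have "norm (W (Suc n)) + \<beta> \<le> a * norm (W n) + norm B + \<beta>"
      using norm_triangle_ineq[of "of_real a * W n" B] a by (simp add: rec norm_mult)
    also have "\<dots> \<le> a * (norm (W n) + \<beta>) + K * Re B" using B by (simp add: algebra_simps)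
    also have "\<dots> \<le> a * (K * Re (W n)) + K * Re B"
      using Suc a by (simp add: mult_left_mono)
    also have "\<dots> = K * Re (W (Suc n))" by (simp add: rec algebra_simps)
    finally show ?case .
  qed
  then have "norm (W n + 1) \<le> K * Re (W n)" for n
    using norm_triangle_ineq[of "W n" 1] \<beta> by (smt (verit) norm_one)
  then show ?thesis using that K by blast
qed

section \<open>Semiconjugacies at an interior fixed point\<close>

text \<open>Conjugating \<open>p\<close> to the origin does not change the multiplier, and by the Schwarz lemma the
  conjugated map is a rotation if the multiplier has modulus at least \<open>1\<close>; then \<open>\<phi>\<close> is an
  automorphism.\<close>

lemma elliptic_multiplier_less_1:
  assumes self: "self_map \<phi>" and na: "\<not> automorphism \<phi>"
    and p: "p \<in> unit_disk" and fix_p: "\<phi> p = p"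
  shows "norm (deriv \<phi> p) < 1"
proof (rule ccontr)
  assume big: "\<not> norm (deriv \<phi> p) < 1"
  define T where "T = Moebius_function 0 p"
  define T' where "T' = Moebius_function 0 (- p)"
  have np: "norm p < 1" using p by simp
  have T: "T p = 0" "T holomorphic_on unit_disk" "T ` unit_disk \<subseteq> unit_disk"
    "T' holomorphic_on unit_disk" "T' ` unit_disk \<subseteq> unit_disk"
    using np by (auto simp: T_def T'_def Moebius_function_eq_zero Moebius_function_holomorphic
        Moebius_function_norm_lt_1)
  have TT': "T (T' z) = z" and T'T: "T' (T z) = z" if "z \<in> unit_disk" for z
    using np that by (auto simp: T_def T'_def Moebius_function_compose)
  have TD: "T z \<in> unit_disk" "T' z \<in> unit_disk" "\<phi> z \<in> unit_disk" if "z \<in> unit_disk" for z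
    using T self that unfolding self_map_def by blast+
  have hol: "\<phi> holomorphic_on unit_disk" using self by (simp add: self_map_def)
  have T'0: "T' 0 = p" using T'T[OF p] T(1) by simp
  have z0: "(0::complex) \<in> unit_disk" by simp
  define g where "g = T \<circ> (\<phi> \<circ> T')"
  have g0: "g 0 = 0" by (simp add: g_def T'0 fix_p T(1))
  have "\<phi> \<circ> T' holomorphic_on unit_disk"
    by (rule holomorphic_on_compose_gen[OF T(4) hol T(5)])
  moreover have "(\<phi> \<circ> T') ` unit_disk \<subseteq> unit_disk"
    using TD(2,3) by (simp add: image_subset_iff)
  ultimately have holg: "g holomorphic_on unit_disk"
    unfolding g_def by (intro holomorphic_on_compose_gen[OF _ T(2)])
  have gD: "norm (g z) < 1" if "norm z < 1" for z
    using TD(1)[OF TD(3)[OF TD(2), of z]] that by (simp add: g_def)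
  have dT: "(T has_field_derivative deriv T p) (at p)"
    and dT': "(T' has_field_derivative deriv T' 0) (at 0)"
    and d\<phi>: "(\<phi> has_field_derivative deriv \<phi> p) (at p)"
    using T hol p z0 holomorphic_derivI open_ball by blast+
  have "((\<lambda>z. T (T' z)) has_field_derivative deriv T p * deriv T' 0) (at 0)"
    using DERIV_chain2[of T "deriv T p" T' 0] dT dT' T'0 by simp
  then have "((\<lambda>z. z) has_field_derivative deriv T p * deriv T' 0) (at 0)"
    by (rule has_field_derivative_transform_within_open[OF _ open_ball z0]) (simp add: TT')
  then have one: "deriv T p * deriv T' 0 = 1" using DERIV_ident DERIV_unique by blast
  have "((\<lambda>z. \<phi> (T' z)) has_field_derivative deriv \<phi> p * deriv T' 0) (at 0)"
    using DERIV_chain2[of \<phi> "deriv \<phi> p" T' 0] d\<phi> dT' T'0 by simp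
  then have "((\<lambda>z. T (\<phi> (T' z))) has_field_derivative deriv T p * (deriv \<phi> p * deriv T' 0)) (at 0)"
    using DERIV_chain2[of T "deriv T p" "\<lambda>z. \<phi> (T' z)" 0] dT T'0 fix_p by simp
  then have "deriv g 0 = deriv T p * (deriv \<phi> p * deriv T' 0)"
    by (intro DERIV_imp_deriv) (simp add: g_def o_def)
  also have "\<dots> = deriv \<phi> p * (deriv T p * deriv T' 0)" by (simp add: ac_simps)
  finally have dg: "deriv g 0 = deriv \<phi> p" using one by simp
  have "norm (deriv g 0) = 1"
    using Schwarz_Lemma(2)[OF holg g0 gD z0[unfolded mem_ball_0]] big dg by simp
  then obtain \<alpha> where rot: "\<And>z. norm z < 1 \<Longrightarrow> g z = \<alpha> * z" and \<alpha>: "norm \<alpha> = 1"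
    using Schwarz_Lemma(3)[OF holg g0 gD z0[unfolded mem_ball_0]] by blast
  have \<phi>: "\<phi> z = T' (\<alpha> * T z)" if z: "z \<in> unit_disk" for z
  proof -
    have "T (\<phi> z) = \<alpha> * T z"
      using rot[of "T z"] TD(1)[OF z] T'T[OF z] by (simp add: g_def)
    then show ?thesis using T'T[OF TD(3)[OF z]] by simp
  qed
  have \<alpha>0: "\<alpha> \<noteq> 0" using \<alpha> by auto
  have rotD: "\<alpha> * z \<in> unit_disk" "z / \<alpha> \<in> unit_disk" if "z \<in> unit_disk" for z
    using that \<alpha> by (simp_all add: norm_mult norm_divide)
  have "bij_betw \<phi> unit_disk unit_disk"
  proof (rule bij_betw_byWitness[where f' = "\<lambda>w. T' (T w / \<alpha>)"])
    show "\<forall>z\<in>unit_disk. T' (T (\<phi> z) / \<alpha>) = z"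
    proof
      fix z assume z: "z \<in> unit_disk"
      have "T (\<phi> z) = \<alpha> * T z" using TT'[OF rotD(1)[OF TD(1)[OF z]]] \<phi>[OF z] by simp
      then show "T' (T (\<phi> z) / \<alpha>) = z" using T'T[OF z] \<alpha>0 by simp
    qed
    show "\<forall>w\<in>unit_disk. \<phi> (T' (T w / \<alpha>)) = w"
    proof
      fix w assume w: "w \<in> unit_disk"
      note D = rotD(2)[OF TD(1)[OF w]]
      show "\<phi> (T' (T w / \<alpha>)) = w"
        using \<phi>[OF TD(2)[OF D]] TT'[OF D] T'T[OF w] \<alpha>0 by simp
    qed
    show "\<phi> ` unit_disk \<subseteq> unit_disk" using TD by blast
    show "(\<lambda>w. T' (T w / \<alpha>)) ` unit_disk \<subseteq> unit_disk" using TD rotD by blast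
  qed
  then show False using na self by (simp add: automorphism_def)
qed

lemma attracting_fixed_point:
  fixes g :: "complex \<Rightarrow> complex"
  assumes der: "(g has_field_derivative l) (at p)" and l: "norm l < 1" and fix_p: "g p = p"
    and U: "open U" "p \<in> U"
  obtains r where "r > 0" "ball p r \<subseteq> U"
    "\<And>z. z \<in> ball p r \<Longrightarrow> g z \<in> ball p r"
    "\<And>z. z \<in> ball p r \<Longrightarrow> (\<lambda>n. (g ^^ n) z) \<longlonglongrightarrow> p"
proof -
  obtain k where k: "norm l < k" "k < 1" using dense[OF l] by blast
  have k0: "k > 0" using k(1) norm_ge_zero[of l] by linarith
  have "((\<lambda>z. (g z - g p) / (z - p)) \<longlongrightarrow> l) (at p)"
    using der by (simp add: has_field_derivative_iff)
  then have "((\<lambda>z. norm ((g z - p) / (z - p))) \<longlongrightarrow> norm l) (at p)"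
    unfolding fix_p by (rule tendsto_norm)
  then have "\<forall>\<^sub>F z in at p. norm ((g z - p) / (z - p)) < k"
    using k(1) by (rule order_tendstoD)
  then obtain \<delta> where \<delta>: "\<delta> > 0"
    "\<And>z. z \<noteq> p \<Longrightarrow> dist z p < \<delta> \<Longrightarrow> norm ((g z - p) / (z - p)) < k"
    unfolding eventually_at by auto
  obtain e where e: "e > 0" "ball p e \<subseteq> U" using U open_contains_ball by blast
  define r where "r = min \<delta> e"
  have con: "dist p (g z) \<le> k * dist p z" if z: "z \<in> ball p r" for z
  proof (cases "z = p")
    case True
    then show ?thesis using k0 by (simp add: fix_p)
  next
    case False
    then have "norm (g z - p) / norm (z - p) < k"
      using \<delta>(2)[of z] z by (simp add: r_def dist_commute norm_divide)
    then show ?thesis using False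
      by (simp add: dist_norm norm_minus_commute divide_less_eq)
  qed
  have inv: "g z \<in> ball p r" if z: "z \<in> ball p r" for z
  proof -
    have "k * dist p z \<le> 1 * dist p z" using k by (intro mult_right_mono) auto
    then show ?thesis using con[OF z] z by simp
  qed
  have orbit_lim: "(\<lambda>n. (g ^^ n) z) \<longlonglongrightarrow> p" if z: "z \<in> ball p r" for z
  proof -
    have b: "(g ^^ n) z \<in> ball p r \<and> dist p ((g ^^ n) z) \<le> k ^ n * dist p z" for n
    proof (induction n)
      case (Suc n)
      have "dist p ((g ^^ Suc n) z) \<le> k * dist p ((g ^^ n) z)" using con Suc by simp
      also have "\<dots> \<le> k * (k ^ n * dist p z)" using Suc k0 by (intro mult_left_mono) auto
      finally show ?case using inv Suc by (simp add: mult.assoc)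
    qed (use z in simp)
    have "(\<lambda>n. k ^ n * dist p z) \<longlonglongrightarrow> 0 * dist p z"
      by (intro tendsto_intros LIMSEQ_realpow_zero) (use k k0 in auto)
    then have geometric: "(\<lambda>n. k ^ n * dist p z) \<longlonglongrightarrow> 0" by simp
    have "(\<lambda>n. dist ((g ^^ n) z) p) \<longlonglongrightarrow> 0"
      by (rule tendsto_sandwich[OF _ _ tendsto_const geometric]) (simp_all add: b dist_commute[of _ p])
    then show ?thesis by (rule tendsto_dist_iff[THEN iffD2])
  qed
  have "r > 0" "ball p r \<subseteq> U" using \<delta>(1) e by (auto simp: r_def)
  then show ?thesis using inv orbit_lim by (rule that)
qed

text \<open>Only orbits that start near \<open>p\<close> are used, since these converge to \<open>p\<close> merely because the
  multiplier has modulus less than \<open>1\<close>.\<close>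

lemma semiconjugacy_elliptic:
  assumes self: "self_map \<phi>" and lf\<phi>: "linear_fractional \<phi>" and na: "\<not> automorphism \<phi>"
    and p: "p \<in> unit_disk" and fix_p: "\<phi> p = p"
    and f: "self_map f" and df: "deriv f p \<noteq> 0"
    and self\<psi>: "self_map \<psi>" and lf\<psi>: "linear_fractional \<psi>"
    and semi: "\<And>z. z \<in> unit_disk \<Longrightarrow> f (\<phi> z) = \<psi> (f z)"
  shows "\<not> is_identity \<psi> \<and> linear_fractional f"
proof -
  have hol\<phi>: "\<phi> holomorphic_on unit_disk" and hol\<psi>: "\<psi> holomorphic_on unit_disk"
    and holf: "f holomorphic_on unit_disk"
    using self self\<psi> f by (simp_all add: self_map_def)
  obtain r where r: "r > 0" "ball p r \<subseteq> unit_disk"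
    and inv: "\<And>z. z \<in> ball p r \<Longrightarrow> \<phi> z \<in> ball p r"
    and lim: "\<And>z. z \<in> ball p r \<Longrightarrow> (\<lambda>n. (\<phi> ^^ n) z) \<longlonglongrightarrow> p"
    by (rule attracting_fixed_point[OF holomorphic_derivI[OF hol\<phi> open_ball p]
          elliptic_multiplier_less_1[OF self na p fix_p] fix_p open_ball p]) (rule that)
  have \<phi>p: "\<phi> z = p \<longleftrightarrow> z = p" if "z \<in> unit_disk" for z
    using linear_fractional_fixes_orbit_limit[OF lf\<phi>, of "\<lambda>_. p" p z] p fix_p that by simp
  have invS: "\<phi> z \<in> ball p r - {p}" if "z \<in> ball p r - {p}" for z
  proof -
    have "z \<in> unit_disk" using that r(2) by blast
    then show ?thesis using that inv[of z] \<phi>p[of z] by simp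
  qed
  have orbS: "(\<phi> ^^ n) z \<in> ball p r - {p}" if "z \<in> ball p r - {p}" for z n
    by (induction n) (use that invS in \<open>simp_all del: mem_ball Diff_iff\<close>)
  show ?thesis
  proof (rule semiconjugacy_linear_fractional[OF lf\<phi> lf\<psi> hol\<phi> hol\<psi> f semi])
    show "open (ball p r - {p})" by (intro open_delete open_ball)
    show "connected (ball p r - {p})" by (rule connected_punctured_ball) simp
    have "p + of_real (r / 2) \<in> ball p r - {p}" using r by (simp add: dist_norm)
    then show "ball p r - {p} \<noteq> {}" by blast
    show "ball p r - {p} \<subseteq> unit_disk" using r by blast
    show "p \<notin> ball p r - {p}" by simp
    show "deriv f p \<noteq> 0" by (rule df)
    fix z assume z: "z \<in> ball p r - {p}"
    show "\<phi> z \<in> ball p r - {p}" by (rule invS[OF z])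
    show limz: "(\<lambda>n. (\<phi> ^^ n) z) \<longlonglongrightarrow> p" using lim z by blast
    have "((\<lambda>z. (f z - f p) / (z - p)) \<longlongrightarrow> deriv f p) (at p)"
      using holomorphic_derivI[OF holf open_ball p] by (simp add: has_field_derivative_iff)
    moreover have "filterlim (\<lambda>n. (\<phi> ^^ n) z) (at p) sequentially"
      using limz orbS[OF z] by (auto simp: filterlim_at)
    ultimately show "(\<lambda>n. (f ((\<phi> ^^ n) z) - f p) / ((\<phi> ^^ n) z - p)) \<longlonglongrightarrow> deriv f p"
      by (rule filterlim_compose)
    have "deriv f holomorphic_on unit_disk" by (intro holomorphic_deriv holf open_ball)
    then have "isCont (deriv f) p"
      using p continuous_on_eq_continuous_at[OF open_ball] by (meson holomorphic_on_imp_continuous_on)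
    then show "(\<lambda>n. deriv f ((\<phi> ^^ n) z)) \<longlonglongrightarrow> deriv f p"
      using limz by (rule isCont_tendsto_compose)
  qed
qed

section \<open>Semiconjugacies at a boundary fixed point\<close>

text \<open>A linear fractional map that fixes \<open>p\<close> becomes affine when \<open>p\<close> is sent to infinity. Its slope is
  the reciprocal of the derivative of \<open>\<phi>\<close> at \<open>p\<close>.\<close>

lemma boundary_cayley_affine:
  assumes self: "self_map \<phi>" and lf: "linear_fractional \<phi>" and p: "norm p = 1"
    and dom: "\<And>n. u n \<in> unit_disk" and orb: "\<And>n. u (Suc n) = \<phi> (u n)"
    and lim: "u \<longlonglongrightarrow> p"
  obtains a B where "a > 0" "Re B \<ge> 0"
    "\<And>z. z \<in> unit_disk \<Longrightarrow> cayley p (\<phi> z) = of_real a * cayley p z + B"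
    "((\<lambda>z. (\<phi> z - p) / (z - p)) \<longlongrightarrow> of_real (1 / a)) (at p within unit_disk)"
proof -
  obtain \<alpha> c e where ne: "\<alpha> \<noteq> 0" "c * p + e \<noteq> 0"
    and den: "\<And>z. z \<in> unit_disk \<Longrightarrow> c * z + e \<noteq> 0"
    and g: "\<And>z. z \<in> unit_disk \<Longrightarrow> \<phi> z = p + \<alpha> * (z - p) / (c * z + e)"
    by (rule linear_fractional_at_orbit_limit[OF lf dom orb lim]) blast
  have \<phi>D: "\<phi> z \<in> unit_disk" if "z \<in> unit_disk" for z
    using self that unfolding self_map_def by blast
  have neq: "z \<noteq> p" if "z \<in> unit_disk" for z using that p by auto
  define A where "A = (c * p + e) / \<alpha>"
  define B where "B = A - 2 * p * c / \<alpha> - 1"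
  have A: "A \<noteq> 0" using ne by (simp add: A_def)
  have aff: "cayley p (\<phi> z) = A * cayley p z + B" if z: "z \<in> unit_disk" for z
  proof -
    have pz: "p - z \<noteq> 0" using neq[OF z] by simp
    have split: "2 * p * (m - c * u) / (\<alpha> * u) = m / \<alpha> * (2 * p / u) - 2 * p * c / \<alpha>"
      if "u \<noteq> 0" for m u
      using that ne by (simp add: field_simps)
    have "p - \<phi> z = \<alpha> * (p - z) / (c * z + e)"
    proof -
      have "- (\<alpha> * (z - p)) = \<alpha> * (p - z)" by (simp add: algebra_simps)
      then show ?thesis by (simp add: g[OF z] minus_divide_left del: minus_mult_right)
    qed
    then have "cayley p (\<phi> z) + 1 = 2 * p * (c * z + e) / (\<alpha> * (p - z))"
      using cayley_plus_one[OF neq[OF \<phi>D[OF z]]] by simp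
    also have "c * z + e = (c * p + e) - c * (p - z)" by (simp add: algebra_simps)
    also have "2 * p * ((c * p + e) - c * (p - z)) / (\<alpha> * (p - z))
        = A * (2 * p / (p - z)) - 2 * p * c / \<alpha>"
      unfolding A_def by (rule split) (rule pz)
    also have "2 * p / (p - z) = cayley p z + 1"
      using cayley_plus_one[OF neq[OF z]] by simp
    finally show ?thesis by (simp add: B_def algebra_simps)
  qed
  have "Re (A * w + B) > 0" if w: "Re w > 0" for w
  proof -
    obtain z where z: "z \<in> unit_disk" "cayley p z = w" using cayley_surj[OF p w] .
    have D: "\<phi> z \<in> unit_disk" by (rule \<phi>D[OF z(1)])
    then have "(norm (\<phi> z))\<^sup>2 < 1" by (simp add: abs_square_less_1)
    then have "Re (cayley p (\<phi> z)) > 0"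
      using neq[OF D] by (simp add: Re_cayley[OF p neq[OF D]])
    then show ?thesis using aff[OF z(1)] z(2) by simp
  qed
  then obtain a where a: "a > 0" "A = of_real a" "Re B \<ge> 0"
    using affine_preserving_half_plane[OF A] by blast
  have "((\<lambda>z. \<alpha> / (c * z + e)) \<longlongrightarrow> \<alpha> / (c * p + e)) (at p within unit_disk)"
    using ne by (intro tendsto_intros) auto
  moreover have "(\<phi> z - p) / (z - p) = \<alpha> / (c * z + e)" if "z \<in> unit_disk" for z
    using neq[OF that] by (simp add: g[OF that])
  then have "\<forall>\<^sub>F z in at p within unit_disk. \<alpha> / (c * z + e) = (\<phi> z - p) / (z - p)"
    by (simp add: eventually_at_filter)
  ultimately have "((\<lambda>z. (\<phi> z - p) / (z - p)) \<longlongrightarrow> \<alpha> / (c * p + e)) (at p within unit_disk)"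
    by (rule Lim_transform_eventually)
  moreover have "\<alpha> / (c * p + e) = 1 / A" by (simp add: A_def)
  moreover have "1 / A = of_real (1 / a)" using a(2) by simp
  ultimately have "((\<lambda>z. (\<phi> z - p) / (z - p)) \<longlongrightarrow> of_real (1 / a)) (at p within unit_disk)"
    by simp
  with a(1,3) aff[unfolded a(2)] show ?thesis by (rule that)
qed

text \<open>A translation along the imaginary axis is a bijection of the half-plane. So for a parabolic
  non-automorphism the translation vector points strictly into the half-plane.\<close>

lemma automorphism_of_cayley_translation:
  assumes self: "self_map \<phi>" and p: "norm p = 1" and B: "Re B = 0"
    and tr: "\<And>z. z \<in> unit_disk \<Longrightarrow> cayley p (\<phi> z) = cayley p z + B"
  shows "automorphism \<phi>"
proof -
  have \<phi>D: "\<phi> z \<in> unit_disk" if "z \<in> unit_disk" for z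
    using self that unfolding self_map_def by blast
  have "inj_on \<phi> unit_disk"
  proof (rule inj_onI)
    fix z w assume zw: "z \<in> unit_disk" "w \<in> unit_disk" "\<phi> z = \<phi> w"
    then have "cayley p z + B = cayley p w + B" using tr by metis
    then show "z = w" using cayley_inj[OF p zw(1,2)] by simp
  qed
  moreover have "\<exists>z\<in>unit_disk. \<phi> z = w" if w: "w \<in> unit_disk" for w
  proof -
    have ne: "w \<noteq> p" using w p by auto
    have "(norm w)\<^sup>2 < 1" using w by (simp add: abs_square_less_1)
    then have "Re (cayley p w - B) > 0" using ne B by (simp add: Re_cayley[OF p ne])
    then obtain z where z: "z \<in> unit_disk" "cayley p z = cayley p w - B"
      by (rule cayley_surj[OF p])
    then have "cayley p (\<phi> z) = cayley p w" using tr by simp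
    then have "\<phi> z = w" using cayley_inj[OF p \<phi>D[OF z(1)] w] by simp
    then show ?thesis using z by blast
  qed
  ultimately show ?thesis
    using self \<phi>D unfolding automorphism_def bij_betw_def by blast
qed

text \<open>The real number \<open>c\<close> is the derivative of \<open>\<phi>\<close> at \<open>p\<close>, so that \<open>c < 1\<close> is the hyperbolic case and
  \<open>c = 1\<close> the parabolic one.\<close>

lemma boundary_orbits_in_stolz_region:
  assumes self: "self_map \<phi>" and lf: "linear_fractional \<phi>" and p: "norm p = 1"
    and lim: "\<And>z. z \<in> unit_disk \<Longrightarrow> (\<lambda>n. (\<phi> ^^ n) z) \<longlonglongrightarrow> p"
    and der: "has_angular_derivative \<phi> p (of_real c)"
    and kind: "c < 1 \<or> c = 1 \<and> \<not> automorphism \<phi>"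
    and z: "z \<in> unit_disk"
  shows "\<exists>M>1. \<forall>n. (\<phi> ^^ n) z \<in> stolz_region M p"
proof -
  have \<phi>D: "\<phi> z \<in> unit_disk" if "z \<in> unit_disk" for z
    using self that unfolding self_map_def by blast
  have orbD: "(\<phi> ^^ n) z \<in> unit_disk" for n
    by (induction n) (use z \<phi>D in simp_all)
  obtain a B where a: "a > 0" and ReB: "Re B \<ge> 0"
    and aff: "\<And>z. z \<in> unit_disk \<Longrightarrow> cayley p (\<phi> z) = of_real a * cayley p z + B"
    and dl: "((\<lambda>z. (\<phi> z - p) / (z - p)) \<longlongrightarrow> of_real (1 / a)) (at p within unit_disk)"
    by (rule boundary_cayley_affine[OF self lf p orbD _ lim[OF z]]) auto
  have "of_real c = (of_real (1 / a) :: complex)"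
    by (rule angular_derivative_unique[OF p der dl])
  then have c: "c = 1 / a" by (simp only: of_real_eq_iff)
  have exp: "a \<ge> 1 \<and> (a > 1 \<or> Re B > 0)"
  proof (cases "c < 1")
    case True
    then show ?thesis using a c by (simp add: divide_less_eq split: if_splits)
  next
    case False
    then have a1: "a = 1" and na: "\<not> automorphism \<phi>" using kind c a by (auto simp: divide_eq_eq)
    have "Re B \<noteq> 0"
      using automorphism_of_cayley_translation[OF self p _, of B] aff na a1 by auto
    then show ?thesis using ReB a1 by simp
  qed
  define W where "W n = cayley p ((\<phi> ^^ n) z)" for n
  have rec: "W (Suc n) = of_real a * W n + B" for n
    using aff[OF orbD[of n]] by (simp add: W_def)
  have ne: "z \<noteq> p" using z p by auto
  have "(norm z)\<^sup>2 < 1" using z by (simp add: abs_square_less_1)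
  then have "Re (W 0) > 0" using ne by (simp add: W_def Re_cayley[OF p ne])
  then obtain K where K: "K \<ge> 0" "\<And>n. norm (W n + 1) \<le> K * Re (W n)"
    using affine_orbit_in_cone[of W a B, OF rec] exp ReB by blast
  show ?thesis
  proof (intro exI conjI allI)
    show "max K 1 + 1 > 1" by simp
    fix n
    have D: "norm ((\<phi> ^^ n) z) < 1" using orbD[of n] by simp
    have "norm ((\<phi> ^^ n) z - p) \<le> K * (1 - norm ((\<phi> ^^ n) z))"
      using norm_diff_le_of_cayley_cone[OF p orbD K(1)] K(2) by (simp add: W_def)
    also have "\<dots> < (max K 1 + 1) * (1 - norm ((\<phi> ^^ n) z))"
      using D by (intro mult_strict_right_mono) auto
    finally show "(\<phi> ^^ n) z \<in> stolz_region (max K 1 + 1) p"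
      using D by (simp add: stolz_region_def)
  qed
qed

lemma semiconjugacy_boundary:
  assumes self: "self_map \<phi>" and lf\<phi>: "linear_fractional \<phi>"
    and p: "norm p = 1"
    and lim: "\<And>z. z \<in> unit_disk \<Longrightarrow> (\<lambda>n. (\<phi> ^^ n) z) \<longlonglongrightarrow> p"
    and der: "has_angular_derivative \<phi> p (of_real c)"
    and kind: "c < 1 \<or> c = 1 \<and> \<not> automorphism \<phi>"
    and f: "self_map f" and d: "d \<noteq> 0" and df: "has_angular_derivative f p d"
    and self\<psi>: "self_map \<psi>" and lf\<psi>: "linear_fractional \<psi>"
    and semi: "\<And>z. z \<in> unit_disk \<Longrightarrow> f (\<phi> z) = \<psi> (f z)"
  shows "\<not> is_identity \<psi> \<and> linear_fractional f"
proof -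
  have hol\<phi>: "\<phi> holomorphic_on unit_disk" and hol\<psi>: "\<psi> holomorphic_on unit_disk"
    and holf: "f holomorphic_on unit_disk"
    using self self\<psi> f by (simp_all add: self_map_def)
  obtain q where q: "has_angular_limit (\<lambda>z. (f z - q) / (z - p)) p d"
    using df unfolding has_angular_derivative_def by blast
  have along: "(\<lambda>n. h ((\<phi> ^^ n) z)) \<longlonglongrightarrow> l"
    if h: "has_angular_limit h p l" and z: "z \<in> unit_disk" for h l z
  proof -
    obtain M where M: "M > 1" "\<And>n. (\<phi> ^^ n) z \<in> stolz_region M p"
      using boundary_orbits_in_stolz_region[OF self lf\<phi> p lim der kind z] by blast
    have "(\<phi> ^^ n) z \<noteq> p" for n using M(2)[of n] p by (auto simp: stolz_region_def)
    then have "filterlim (\<lambda>n. (\<phi> ^^ n) z) (at p within stolz_region M p) sequentially"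
      using lim[OF z] M(2) by (simp add: filterlim_at)
    moreover have "(h \<longlongrightarrow> l) (at p within stolz_region M p)"
      using h M(1) by (simp add: has_angular_limit_def)
    ultimately show ?thesis by (rule filterlim_compose[rotated])
  qed
  show ?thesis
  proof (rule semiconjugacy_linear_fractional[OF lf\<phi> lf\<psi> hol\<phi> hol\<psi> f semi, of unit_disk p d q])
    show "\<phi> z \<in> unit_disk" if "z \<in> unit_disk" for z
      using self that unfolding self_map_def by blast
    show "(\<lambda>n. (f ((\<phi> ^^ n) z) - q) / ((\<phi> ^^ n) z - p)) \<longlonglongrightarrow> d" if "z \<in> unit_disk" for z
      using along[OF q that] .
    show "(\<lambda>n. deriv f ((\<phi> ^^ n) z)) \<longlonglongrightarrow> d" if "z \<in> unit_disk" for z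
      using along[OF angular_limit_deriv[OF holf q p] that] .
    show "(\<lambda>n. (\<phi> ^^ n) z) \<longlonglongrightarrow> p" if "z \<in> unit_disk" for z using lim[OF that] .
    show "p \<notin> unit_disk" using p by simp
    show "unit_disk \<noteq> {}" by simp
    show "open unit_disk" "connected unit_disk" "unit_disk \<subseteq> unit_disk" by simp_all
    show "d \<noteq> 0" by (rule d)
  qed
qed

section \<open>Semiconjugacies between linear fractional self-maps\<close>

theorem theorem4:
  fixes \<phi> \<psi> f :: "complex \<Rightarrow> complex" and p :: complex
  assumes "self_map \<phi>" and "linear_fractional \<phi>"
    and "(elliptic \<phi> \<and> \<not> automorphism \<phi>) \<or> (parabolic \<phi> \<and> \<not> automorphism \<phi>) \<or> hyperbolic \<phi>"
    and "denjoy_wolff_point \<phi> p"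
    and "self_map f" and "conformal_at f p"
    and "self_map \<psi>" and "linear_fractional \<psi>"
    and "\<forall>z\<in>unit_disk. f (\<phi> z) = \<psi> (f z)"
  shows "\<not> is_identity \<psi> \<and> linear_fractional f"
proof (cases "\<exists>z\<in>unit_disk. \<phi> z = z")
  case True
  then have p: "p \<in> unit_disk" "\<phi> p = p"
    using assms(4) by (simp_all add: denjoy_wolff_point_def)
  have "\<not> denjoy_wolff_point \<phi> p'" if "p' \<in> sphere 0 1" for p'
    using True that by (auto simp: denjoy_wolff_point_def)
  then have "\<not> parabolic \<phi>" "\<not> hyperbolic \<phi>"
    unfolding parabolic_def hyperbolic_def by blast+
  then have "\<not> automorphism \<phi>" using assms(3) by blast
  moreover have "deriv f p \<noteq> 0"
    using assms(6) p(1) by (auto simp: conformal_at_def)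
  ultimately show ?thesis
    using semiconjugacy_elliptic[of \<phi> p f \<psi>] assms p by blast
next
  case False
  have to_bdry: "norm p' = 1 \<and> (\<forall>z\<in>unit_disk. (\<lambda>n. (\<phi> ^^ n) z) \<longlonglongrightarrow> p')"
    if "denjoy_wolff_point \<phi> p'" for p'
  proof -
    have p': "p' \<in> sphere 0 1" and u: "\<And>K. compact K \<Longrightarrow> K \<subseteq> unit_disk \<Longrightarrow>
        uniform_limit K (\<lambda>n. \<phi> ^^ n) (\<lambda>_. p') sequentially"
      using that False unfolding denjoy_wolff_point_def by auto
    have "(\<lambda>n. (\<phi> ^^ n) z) \<longlonglongrightarrow> p'" if "z \<in> unit_disk" for z
      using tendsto_uniform_limitI[OF u[of "{z}"], of z] that by simp
    then show ?thesis using p' by simp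
  qed
  \<comment> \<open>The points in the definitions of parabolic and hyperbolic maps are the given one, as all of
    them are limits of the orbit of \<open>0\<close>.\<close>
  have unique: "p' = p" if "denjoy_wolff_point \<phi> p'" for p'
    using to_bdry[OF that] to_bdry[OF assms(4)] LIMSEQ_unique by (metis centre_in_ball zero_less_one)
  have "\<not> elliptic \<phi>" using False by (simp add: elliptic_def)
  then obtain c :: real where c: "has_angular_derivative \<phi> p (of_real c)"
    "c < 1 \<or> c = 1 \<and> \<not> automorphism \<phi>"
    using assms(3) unique unfolding parabolic_def hyperbolic_def by (metis of_real_1)
  obtain d where d: "d \<noteq> 0" "has_angular_derivative f p d"
    using assms(6) to_bdry[OF assms(4)] by (auto simp: conformal_at_def)
  show ?thesis
    using semiconjugacy_boundary[of \<phi> p c f d \<psi>] to_bdry[OF assms(4)] c d assms by blast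
qed

end
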